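(* For all names $P,Q,R,S$: if $\eta\,P\,\mathit{Region}$, $\eta\,Q\,\mathit{Region}$, $(\mathit{InteriorPoint}\,P)\subseteq(\mathit{InteriorPoint}\,Q)$, $\eta\,R\,(klass\,(\mathit{InteriorPoint}\,P))$ and $\eta\,S\,(klass\,(\mathit{InteriorPoint}\,Q))$, then $\eta\,R\,(pt\,S)$.
   Context: Setting: a Coq formalization (classical logic) of Leśniewski's Ontology and Mereology extended with Tarski's geometry of solids. Names form a type $N$ with a primitive relation $\eta:N\to N\to\mathrm{Prop}$ satisfying Leśniewski's ontological axiom $\eta\,A\,b \leftrightarrow ((\exists C,\eta\,C\,A)\wedge(\forall C\,D,\eta\,C\,A\wedge\eta\,D\,A\to\eta\,C\,D)\wedge(\forall C,\eta\,C\,A\to\eta\,C\,b))$; $A$ is an individual iff $\eta\,A\,A$; $a\subseteq b$ means $\forall P,\eta\,P\,a\to\eta\,P\,b$. Mereology: $pt:N\to N$ ($\eta\,B\,(pt\,A)$: $B$ is a part of $A$) satisfying Leśniewski's mereology axioms (part-of a partial order on individuals; every non-empty name has a unique m-class). M-class: $\eta\,A\,(klass\,a)$ iff $\eta\,A\,A$, $\forall B,\eta\,B\,a\to\eta\,B\,(pt\,A)$, and $\forall B,\eta\,B\,(pt\,A)\to\exists C\,D,\eta\,C\,a\wedge\eta\,D\,(pt\,C)\wedge\eta\,D\,(pt\,B)$. $X$ is exterior to $Y$ iff they have no common part. Geometry: $\mathit{balls}$ is a primitive name (there exists at least one ball). Tarski's definitions for balls: $A$ is externally tangent to $B$ iff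 $A$ is exterior to $B$ and for any balls $X,Y$ both having $A$ as part and both exterior to $B$, one of $X,Y$ is part of the other; $A$ is internally tangent to $B$ iff $A$ is a proper part of $B$ and for any balls $X,Y$ both having $A$ as a part and both parts of $B$, one of $X,Y$ is part of the other; $A,B$ are externally diametrical w.r.t. $C$ iff both are externally tangent to $C$ and for any balls $X,Y$ exterior to $C$ with $A$ part of $X$ and $B$ part of $Y$, $X$ is exterior to $Y$; $A,B$ are internally diametrical w.r.t. $C$ iff both are internally tangent to $C$ and for any balls $X,Y$ externally tangent to $C$ with $A$ exterior to $X$ and $B$ exterior to $Y$, $X$ is exterior to $Y$; $A$ is concentric with $B$ iff $A=B$, or $A$ is a proper part of $B$ and any balls $X,Y$ externally diametrical w.r.t. $A$ and internally tangent to $B$ are internally diametrical w.r.t. $B$, or the same holds with $A,B$ interchanged. $\eta\,P\,(\mathit{Concent}\,Q)$ iff $P,Q$ are balls and $P$ is concentric with $Q$. Point: $\eta\,P\,(\mathit{Point}\,Q)$ iff $\eta\,P\,\mathit{balls}\wedge\eta\,Q\,\mathit{balls}\wedge\eta\,P\,(\mathit{Concent}\,Q)$. Region: $\eta\,P\,\mathit{Region}$ iff $\eta\,P\,P$ and $\exists b,\ b\subseteq\mathit{balls}\wedge\eta\,P\,(klass\,b)$. Interior point: $\eta\,P\,(\mathit{InteriorPoint}\,Q)$ iff $\eta\,Q\,\mathit{Region}$ and $\exists P',\ \eta\,P\,(\mathit{Point}\,P')\wedge\eta\,P'\,(pt\,Q)$.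
   Formalization: The formal version adds Ontology's rule of definition as an axiom: every condition on individuals defines a name. From only the listed ontological and mereological axioms the claim fails (a finite countermodel lacks the name comprising just R and S). *)

theory Defs
  imports Main
begin

section \<open>Ontology\<close>

text \<open>
  The second assumption is the rule of definition of Ontology (every condition on individuals
  is the defining condition of some name). It is what licenses introducing name-forming functors
  by clauses of the form \<open>\<eta> A (f x) \<longleftrightarrow> \<eta> A A \<and> \<dots>\<close>.
\<close>

locale ontology =
  fixes \<eta> :: "'n \<Rightarrow> 'n \<Rightarrow> bool"
  assumes ontological_axiom:
    "\<eta> A b \<longleftrightarrow>
       (\<exists>C. \<eta> C A) \<and> (\<forall>C D. \<eta> C A \<and> \<eta> D A \<longrightarrow> \<eta> C D) \<and> (\<forall>C. \<eta> C A \<longrightarrow> \<eta> C b)"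
  and rule_of_definition:
    "\<exists>a. \<forall>A. \<eta> A a \<longleftrightarrow> \<eta> A A \<and> \<phi> A"

definition name_of :: "('n \<Rightarrow> 'n \<Rightarrow> bool) \<Rightarrow> ('n \<Rightarrow> bool) \<Rightarrow> 'n" where
  "name_of \<eta> \<phi> = (SOME a. \<forall>A. \<eta> A a \<longleftrightarrow> \<eta> A A \<and> \<phi> A)"

definition included :: "('n \<Rightarrow> 'n \<Rightarrow> bool) \<Rightarrow> 'n \<Rightarrow> 'n \<Rightarrow> bool" where
  "included \<eta> a b \<longleftrightarrow> (\<forall>P. \<eta> P a \<longrightarrow> \<eta> P b)"

context ontology
begin

lemma eta_individual: "\<eta> A b \<Longrightarrow> \<eta> A A"
  using ontological_axiom[of A b] ontological_axiom[of A A] by blast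

lemma eta_name_of: "\<eta> A (name_of \<eta> \<phi>) \<longleftrightarrow> \<eta> A A \<and> \<phi> A"
proof -
  have "\<forall>A. \<eta> A (name_of \<eta> \<phi>) \<longleftrightarrow> \<eta> A A \<and> \<phi> A"
    unfolding name_of_def by (rule someI_ex) (rule rule_of_definition)
  then show ?thesis by blast
qed

text \<open>On individuals, HOL equality is the singular identity of Ontology.\<close>

lemma singular_identity:
  assumes "\<eta> A A"
  shows "A = B \<longleftrightarrow> \<eta> A B \<and> \<eta> B A"
proof
  assume "\<eta> A B \<and> \<eta> B A"
  moreover have "\<eta> A (name_of \<eta> (\<lambda>X. X = A))"
    using assms by (simp add: eta_name_of)
  ultimately have "\<eta> B (name_of \<eta> (\<lambda>X. X = A))"
    using ontological_axiom[of A "name_of \<eta> (\<lambda>X. X = A)"] by blast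
  then show "A = B" by (simp add: eta_name_of)
qed (use assms in simp)

end


section \<open>Mereology\<close>

text \<open>Throughout, \<open>pt\<close> is the reflexive notion of part.\<close>

definition klass :: "('n \<Rightarrow> 'n \<Rightarrow> bool) \<Rightarrow> ('n \<Rightarrow> 'n) \<Rightarrow> 'n \<Rightarrow> 'n" where
  "klass \<eta> pt a = name_of \<eta> (\<lambda>A.
     (\<forall>B. \<eta> B a \<longrightarrow> \<eta> B (pt A)) \<and>
     (\<forall>B. \<eta> B (pt A) \<longrightarrow> (\<exists>C D. \<eta> C a \<and> \<eta> D (pt C) \<and> \<eta> D (pt B))))"

locale mereology = ontology \<eta> for \<eta> :: "'n \<Rightarrow> 'n \<Rightarrow> bool" +
  fixes pt :: "'n \<Rightarrow> 'n"
  assumes part_of_individual: "\<eta> A (pt B) \<Longrightarrow> \<eta> B B"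
  and part_refl: "\<eta> A A \<Longrightarrow> \<eta> A (pt A)"
  and part_antisym: "\<eta> A (pt B) \<Longrightarrow> \<eta> B (pt A) \<Longrightarrow> A = B"
  and part_trans: "\<eta> A (pt B) \<Longrightarrow> \<eta> B (pt C) \<Longrightarrow> \<eta> A (pt C)"
  and klass_exists: "\<eta> A a \<Longrightarrow> \<exists>B. \<eta> B (klass \<eta> pt a)"
  and klass_unique: "\<eta> A (klass \<eta> pt a) \<Longrightarrow> \<eta> B (klass \<eta> pt a) \<Longrightarrow> A = B"

lemma (in ontology) eta_klass:
  "\<eta> A (klass \<eta> pt a) \<longleftrightarrow>
     \<eta> A A \<and> (\<forall>B. \<eta> B a \<longrightarrow> \<eta> B (pt A)) \<and>
     (\<forall>B. \<eta> B (pt A) \<longrightarrow> (\<exists>C D. \<eta> C a \<and> \<eta> D (pt C) \<and> \<eta> D (pt B)))"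
  by (simp add: klass_def eta_name_of)

definition exterior :: "('n \<Rightarrow> 'n \<Rightarrow> bool) \<Rightarrow> ('n \<Rightarrow> 'n) \<Rightarrow> 'n \<Rightarrow> 'n \<Rightarrow> bool" where
  "exterior \<eta> pt X Y \<longleftrightarrow> \<not> (\<exists>Z. \<eta> Z (pt X) \<and> \<eta> Z (pt Y))"

definition proper_part :: "('n \<Rightarrow> 'n \<Rightarrow> bool) \<Rightarrow> ('n \<Rightarrow> 'n) \<Rightarrow> 'n \<Rightarrow> 'n \<Rightarrow> bool" where
  "proper_part \<eta> pt A B \<longleftrightarrow> \<eta> A (pt B) \<and> A \<noteq> B"


section \<open>Geometry of solids\<close>

locale geometry_of_solids = mereology \<eta> pt
  for \<eta> :: "'n \<Rightarrow> 'n \<Rightarrow> bool" and pt :: "'n \<Rightarrow> 'n" +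
  fixes balls :: 'n
  assumes ball_exists: "\<exists>B. \<eta> B balls"

text \<open>
  The next five relations are meant for balls only; \<open>Concent\<close> applies them to nothing else.
\<close>

definition externally_tangent ::
    "('n \<Rightarrow> 'n \<Rightarrow> bool) \<Rightarrow> ('n \<Rightarrow> 'n) \<Rightarrow> 'n \<Rightarrow> 'n \<Rightarrow> 'n \<Rightarrow> bool" where
  "externally_tangent \<eta> pt balls A B \<longleftrightarrow>
     exterior \<eta> pt A B \<and>
     (\<forall>X Y. \<eta> X balls \<and> \<eta> Y balls \<and> \<eta> A (pt X) \<and> \<eta> A (pt Y) \<and>
        exterior \<eta> pt X B \<and> exterior \<eta> pt Y B \<longrightarrow> \<eta> X (pt Y) \<or> \<eta> Y (pt X))"

definition internally_tangent ::
    "('n \<Rightarrow> 'n \<Rightarrow> bool) \<Rightarrow> ('n \<Rightarrow> 'n) \<Rightarrow> 'n \<Rightarrow> 'n \<Rightarrow> 'n \<Rightarrow> bool" where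
  "internally_tangent \<eta> pt balls A B \<longleftrightarrow>
     proper_part \<eta> pt A B \<and>
     (\<forall>X Y. \<eta> X balls \<and> \<eta> Y balls \<and> \<eta> A (pt X) \<and> \<eta> A (pt Y) \<and>
        \<eta> X (pt B) \<and> \<eta> Y (pt B) \<longrightarrow> \<eta> X (pt Y) \<or> \<eta> Y (pt X))"

definition externally_diametrical ::
    "('n \<Rightarrow> 'n \<Rightarrow> bool) \<Rightarrow> ('n \<Rightarrow> 'n) \<Rightarrow> 'n \<Rightarrow> 'n \<Rightarrow> 'n \<Rightarrow> 'n \<Rightarrow> bool" where
  "externally_diametrical \<eta> pt balls A B C \<longleftrightarrow>
     externally_tangent \<eta> pt balls A C \<and> externally_tangent \<eta> pt balls B C \<and>
     (\<forall>X Y. \<eta> X balls \<and> \<eta> Y balls \<and> exterior \<eta> pt X C \<and> exterior \<eta> pt Y C \<and>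
        \<eta> A (pt X) \<and> \<eta> B (pt Y) \<longrightarrow> exterior \<eta> pt X Y)"

definition internally_diametrical ::
    "('n \<Rightarrow> 'n \<Rightarrow> bool) \<Rightarrow> ('n \<Rightarrow> 'n) \<Rightarrow> 'n \<Rightarrow> 'n \<Rightarrow> 'n \<Rightarrow> 'n \<Rightarrow> bool" where
  "internally_diametrical \<eta> pt balls A B C \<longleftrightarrow>
     internally_tangent \<eta> pt balls A C \<and> internally_tangent \<eta> pt balls B C \<and>
     (\<forall>X Y. \<eta> X balls \<and> \<eta> Y balls \<and>
        externally_tangent \<eta> pt balls X C \<and> externally_tangent \<eta> pt balls Y C \<and>
        exterior \<eta> pt A X \<and> exterior \<eta> pt B Y \<longrightarrow> exterior \<eta> pt X Y)"

definition concentric ::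
    "('n \<Rightarrow> 'n \<Rightarrow> bool) \<Rightarrow> ('n \<Rightarrow> 'n) \<Rightarrow> 'n \<Rightarrow> 'n \<Rightarrow> 'n \<Rightarrow> bool" where
  "concentric \<eta> pt balls A B \<longleftrightarrow>
     A = B \<or>
     (proper_part \<eta> pt A B \<and>
       (\<forall>X Y. \<eta> X balls \<and> \<eta> Y balls \<and> externally_diametrical \<eta> pt balls X Y A \<and>
          internally_tangent \<eta> pt balls X B \<and> internally_tangent \<eta> pt balls Y B \<longrightarrow>
          internally_diametrical \<eta> pt balls X Y B)) \<or>
     (proper_part \<eta> pt B A \<and>
       (\<forall>X Y. \<eta> X balls \<and> \<eta> Y balls \<and> externally_diametrical \<eta> pt balls X Y B \<and>
          internally_tangent \<eta> pt balls X A \<and> internally_tangent \<eta> pt balls Y A \<longrightarrow>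
          internally_diametrical \<eta> pt balls X Y A))"

definition Concent :: "('n \<Rightarrow> 'n \<Rightarrow> bool) \<Rightarrow> ('n \<Rightarrow> 'n) \<Rightarrow> 'n \<Rightarrow> 'n \<Rightarrow> 'n" where
  "Concent \<eta> pt balls Q = name_of \<eta> (\<lambda>P.
     \<eta> P balls \<and> \<eta> Q balls \<and> concentric \<eta> pt balls P Q)"

definition Point :: "('n \<Rightarrow> 'n \<Rightarrow> bool) \<Rightarrow> ('n \<Rightarrow> 'n) \<Rightarrow> 'n \<Rightarrow> 'n \<Rightarrow> 'n" where
  "Point \<eta> pt balls Q = name_of \<eta> (\<lambda>P.
     \<eta> P balls \<and> \<eta> Q balls \<and> \<eta> P (Concent \<eta> pt balls Q))"

definition Region :: "('n \<Rightarrow> 'n \<Rightarrow> bool) \<Rightarrow> ('n \<Rightarrow> 'n) \<Rightarrow> 'n \<Rightarrow> 'n" where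
  "Region \<eta> pt balls = name_of \<eta> (\<lambda>P.
     \<exists>b. included \<eta> b balls \<and> \<eta> P (klass \<eta> pt b))"

definition InteriorPoint :: "('n \<Rightarrow> 'n \<Rightarrow> bool) \<Rightarrow> ('n \<Rightarrow> 'n) \<Rightarrow> 'n \<Rightarrow> 'n \<Rightarrow> 'n" where
  "InteriorPoint \<eta> pt balls Q = name_of \<eta> (\<lambda>P.
     \<eta> Q (Region \<eta> pt balls) \<and> (\<exists>P'. \<eta> P (Point \<eta> pt balls P') \<and> \<eta> P' (pt Q)))"

context ontology
begin

lemma eta_Concent:
  "\<eta> P (Concent \<eta> pt balls Q) \<longleftrightarrow> \<eta> P balls \<and> \<eta> Q balls \<and> concentric \<eta> pt balls P Q"
  by (auto simp: Concent_def eta_name_of dest: eta_individual)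

lemma eta_Point:
  "\<eta> P (Point \<eta> pt balls Q) \<longleftrightarrow> \<eta> P balls \<and> \<eta> Q balls \<and> \<eta> P (Concent \<eta> pt balls Q)"
  by (auto simp: Point_def eta_name_of dest: eta_individual)

lemma eta_Region:
  "\<eta> P (Region \<eta> pt balls) \<longleftrightarrow>
     \<eta> P P \<and> (\<exists>b. included \<eta> b balls \<and> \<eta> P (klass \<eta> pt b))"
  by (simp add: Region_def eta_name_of)

lemma eta_InteriorPoint:
  "\<eta> P (InteriorPoint \<eta> pt balls Q) \<longleftrightarrow>
     \<eta> Q (Region \<eta> pt balls) \<and> (\<exists>P'. \<eta> P (Point \<eta> pt balls P') \<and> \<eta> P' (pt Q))"
  by (auto simp: InteriorPoint_def eta_name_of dest: eta_individual)

end

end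

theory Submission imports Defs begin

text \<open>
  The m-class is monotone in its name: every part of the m-class of \<open>a\<close> overlaps some \<open>a\<close>, hence,
  if \<open>a \<subseteq> b\<close>, the m-class of \<open>b\<close>; and an individual each of whose parts overlaps \<open>B\<close> is a part of
  \<open>B\<close>.
\<close>

context mereology
begin

text \<open>
  Strong supplementation, from uniqueness of m-classes: the sum of \<open>A\<close> and \<open>B\<close> and \<open>B\<close> itself are
  both m-classes of the parts of \<open>B\<close>.
\<close>

lemma part_if_parts_overlap:
  assumes A: "\<eta> A A" and B: "\<eta> B B"
    and overlap: "\<And>C. \<eta> C (pt A) \<Longrightarrow> \<not> exterior \<eta> pt C B"
  shows "\<eta> A (pt B)"
proof -
  \<comment> \<open>The name of exactly \<open>A\<close> and \<open>B\<close>; its m-class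
    \<open>T\<close> below is their sum.\<close>
  define c where "c = name_of \<eta> (\<lambda>X. X = A \<or> X = B)"
  have c: "\<eta> X c \<longleftrightarrow> X = A \<or> X = B" for X
    using A B by (auto simp: c_def eta_name_of)
  then obtain T where "\<eta> T (klass \<eta> pt c)"
    using klass_exists by blast
  then have T: "\<eta> T T" "\<eta> A (pt T)" "\<eta> B (pt T)"
    and T_parts: "\<And>X. \<eta> X (pt T) \<Longrightarrow> \<exists>C D. (C = A \<or> C = B) \<and> \<eta> D (pt C) \<and> \<eta> D (pt X)"
    unfolding eta_klass c by blast+
  \<comment> \<open>If the common part given by \<open>T_parts\<close> lies in \<open>A\<close>,
    then \<open>overlap\<close> applies to it and yields a part of it in \<open>B\<close>, which is
    in \<open>X\<close> by transitivity.\<close>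
  have "\<exists>D. \<eta> D (pt B) \<and> \<eta> D (pt X)" if "\<eta> X (pt T)" for X
    using T_parts[OF that] overlap part_trans unfolding exterior_def by blast
  then have "\<eta> T (klass \<eta> pt (pt B))"
    unfolding eta_klass using T part_trans part_refl eta_individual by metis
  moreover have "\<eta> B (klass \<eta> pt (pt B))"
    unfolding eta_klass using B part_refl eta_individual by metis
  ultimately have "T = B" by (rule klass_unique)
  with T show ?thesis by simp
qed

lemma klass_mono:
  assumes ab: "included \<eta> a b"
    and R: "\<eta> R (klass \<eta> pt a)" and S: "\<eta> S (klass \<eta> pt b)"
  shows "\<eta> R (pt S)"
proof (rule part_if_parts_overlap)
  show "\<eta> R R" "\<eta> S S"
    using R S eta_individual by blast+
  fix X
  assume "\<eta> X (pt R)"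
  with R obtain C D where "\<eta> C a" "\<eta> D (pt C)" "\<eta> D (pt X)"
    unfolding eta_klass by blast
  \<comment> \<open>Since \<open>C\<close> lies in \<open>S\<close>, so does \<open>D\<close>, which
    is then a common part of \<open>X\<close> and \<open>S\<close>.\<close>
  moreover from \<open>\<eta> C a\<close> ab S have "\<eta> C (pt S)"
    unfolding eta_klass included_def by blast
  ultimately show "\<not> exterior \<eta> pt X S"
    using part_trans unfolding exterior_def by blast
qed

end

theorem theorem5:
  fixes \<eta> :: "'n \<Rightarrow> 'n \<Rightarrow> bool" and pt :: "'n \<Rightarrow> 'n" and balls P Q R S :: 'n
  assumes "geometry_of_solids \<eta> pt balls"
    and "\<eta> P (Region \<eta> pt balls)"
    and "\<eta> Q (Region \<eta> pt balls)"
    and "included \<eta> (InteriorPoint \<eta> pt balls P) (InteriorPoint \<eta> pt balls Q)"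
    and "\<eta> R (klass \<eta> pt (InteriorPoint \<eta> pt balls P))"
    and "\<eta> S (klass \<eta> pt (InteriorPoint \<eta> pt balls Q))"
  shows "\<eta> R (pt S)"
proof -
  interpret geometry_of_solids \<eta> pt balls by fact
  show ?thesis using assms(4-6) by (rule klass_mono)
qed

end
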